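(* Let $A,X\in B(\mathcal{H})$, where $A$ is Drazin invertible with Drazin inverse $A_d$ and Drazin index $p$, let $m\ge1$ be an integer, and write $\mathcal{H}=\mathcal{H}_1\oplus\mathcal{H}_2$ with $\mathcal{H}_1=A^p(\mathcal{H})$ and $\mathcal{H}_2=A^{-p}(0)=\ker(A^p)$. (i) If $(B,A)$ is left-$(X,m)$-invertible, that is, $\triangle_{B,A}^m(X)=0$, and $B=A$ or $A^*$ or $A_d$ or $A_d^*$, then $X=X_{11}\oplus 0\in B(\mathcal{H}_1\oplus\mathcal{H}_2)$. Consequently, one has: (ii) $$\triangle_{A,A}^m(X)=0\Longrightarrow\delta_{A_d,A}^m(X)=0;$$ $$\triangle_{A_d,A}^m(X)=0\Longrightarrow\delta_{A,A}^m(X)=0;$$ $$\triangle_{A^*,A}^m(X)=0\Longrightarrow\delta_{A_d^*,A}^m(X)=0;$$ $$\triangle_{A_d^*,A}^m(X)=0\Longrightarrow\delta_{A^*,A}^m(X)=0.$$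
   Context: $\mathcal{H}$ is an infinite dimensional complex Hilbert space and $B(\mathcal{H})$ is the algebra of bounded linear operators on $\mathcal{H}$. For $S,T,X\in B(\mathcal{H})$ and an integer $m\ge 1$ put $$\triangle_{S,T}^m(X)=\sum_{j=0}^m(-1)^j\binom{m}{j}S^{m-j}XT^{m-j},\qquad \delta_{S,T}^m(X)=\sum_{j=0}^m(-1)^j\binom{m}{j}S^{m-j}XT^{j}.$$ The pair $(S,T)$ is called left-$(X,m)$-invertible if $\triangle_{S,T}^m(X)=0$. An operator $A\in B(\mathcal{H})$ is Drazin invertible, with Drazin inverse $A_d\in B(\mathcal{H})$, if $A_dA=AA_d$, $A_d^2A=A_d$ and $A^{p+1}A_d=A^p$ for some integer $p\ge1$; the least such $p$ is the Drazin index of $A$. $A_d^*$ denotes the adjoint $(A_d)^*$. The Drazin invertibility of $A$ induces the decomposition $\mathcal{H}=A^p(\mathcal{H})\oplus A^{-p}(0)=\mathcal{H}_1\oplus\mathcal{H}_2$, where $A^{-p}(0)=\ker(A^p)$, with $A=A_1\oplus A_2$, $A_1=A|_{\mathcal{H}_1}$ invertible, $A_2=A|_{\mathcal{H}_2}$ $p$-nilpotent, and $A_d=A_1^{-1}\oplus 0$. That $X=X_{11}\oplus 0\in B(\mathcal{H}_1\oplus\mathcal{H}_2)$ means that, in the matrix representation $X=[X_{ik}]_{i,k=1}^2$ of $X$ with respect to this decomposition, $X_{12}=X_{21}=X_{22}=0$.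
   Formalization: For B = A* or A_d*, part (i) is stated only when H_1 and H_2 are orthogonal; for oblique H_1, H_2 it fails: with e, f orthonormal, Ax = <x,e+f>e, m = 1, X = A*A one has A*XA = X but X_21 ≠ 0. Part (ii) is unrestricted. *)

theory Defs
  imports "HOL-Analysis.Analysis"
begin

(* The inner product is linear in the first argument. *)
class complex_inner = real_normed_vector +
  fixes scaleC :: "complex \<Rightarrow> 'a \<Rightarrow> 'a" (infixr \<open>*\<^sub>C\<close> 75)
    and cinner :: "'a \<Rightarrow> 'a \<Rightarrow> complex"
  assumes scaleC_add_right: "c *\<^sub>C (x + y) = c *\<^sub>C x + c *\<^sub>C y"
    and scaleC_add_left: "(c + d) *\<^sub>C x = c *\<^sub>C x + d *\<^sub>C x"
    and scaleC_scaleC: "c *\<^sub>C d *\<^sub>C x = (c * d) *\<^sub>C x"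
    and scaleC_one: "1 *\<^sub>C x = x"
    and scaleR_scaleC: "r *\<^sub>R x = complex_of_real r *\<^sub>C x"
    and cinner_commute: "cinner x y = cnj (cinner y x)"
    and cinner_add_left: "cinner (x + y) z = cinner x z + cinner y z"
    and cinner_scaleC_left: "cinner (c *\<^sub>C x) y = c * cinner x y"
    and norm_eq_cinner: "complex_of_real ((norm x)\<^sup>2) = cinner x x"

class chilbert_space = complex_inner + complete_space

global_interpretation complex_space: vector_space "scaleC :: complex \<Rightarrow> 'a \<Rightarrow> 'a::complex_inner"
  by unfold_locales
    (simp_all add: scaleC_add_right scaleC_add_left scaleC_scaleC scaleC_one)

definition infinite_dimensional :: "'a::complex_inner itself \<Rightarrow> bool" where
  "infinite_dimensional _ \<longleftrightarrow> (\<nexists>S :: 'a set. finite S \<and> complex_space.span S = UNIV)"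

definition bounded_ops :: "('a::complex_inner \<Rightarrow> 'a) set" where
  "bounded_ops = {A. bounded_linear A \<and> (\<forall>c x. A (c *\<^sub>C x) = c *\<^sub>C A x)}"

definition cadjoint :: "('a::chilbert_space \<Rightarrow> 'a) \<Rightarrow> 'a \<Rightarrow> 'a" where
  "cadjoint A = (THE G. \<forall>x y. cinner (A x) y = cinner x (G y))"

definition triangle ::
    "nat \<Rightarrow> ('a::complex_inner \<Rightarrow> 'a) \<Rightarrow> ('a \<Rightarrow> 'a) \<Rightarrow> ('a \<Rightarrow> 'a) \<Rightarrow> 'a \<Rightarrow> 'a" where
  "triangle m S T X = (\<lambda>x. \<Sum>j=0..m.
     ((- 1) ^ j * of_nat (m choose j)) *\<^sub>C ((S ^^ (m - j)) \<circ> X \<circ> (T ^^ (m - j))) x)"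

definition delta ::
    "nat \<Rightarrow> ('a::complex_inner \<Rightarrow> 'a) \<Rightarrow> ('a \<Rightarrow> 'a) \<Rightarrow> ('a \<Rightarrow> 'a) \<Rightarrow> 'a \<Rightarrow> 'a" where
  "delta m S T X = (\<lambda>x. \<Sum>j=0..m.
     ((- 1) ^ j * of_nat (m choose j)) *\<^sub>C ((S ^^ (m - j)) \<circ> X \<circ> (T ^^ j)) x)"

definition left_invertible ::
    "('a::complex_inner \<Rightarrow> 'a) \<Rightarrow> nat \<Rightarrow> ('a \<Rightarrow> 'a) \<Rightarrow> ('a \<Rightarrow> 'a) \<Rightarrow> bool" where
  "left_invertible X m S T \<longleftrightarrow> triangle m S T X = (\<lambda>x. 0)"

definition drazin_inverse :: "('a::complex_inner \<Rightarrow> 'a) \<Rightarrow> ('a \<Rightarrow> 'a) \<Rightarrow> bool" where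
  "drazin_inverse A Ad \<longleftrightarrow> Ad \<in> bounded_ops \<and> Ad \<circ> A = A \<circ> Ad \<and> (Ad ^^ 2) \<circ> A = Ad \<and>
     (\<exists>p\<ge>1. (A ^^ (p + 1)) \<circ> Ad = A ^^ p)"

definition drazin_index :: "('a \<Rightarrow> 'a) \<Rightarrow> ('a \<Rightarrow> 'a) \<Rightarrow> nat" where
  "drazin_index A Ad = (LEAST p. p \<ge> 1 \<and> (A ^^ (p + 1)) \<circ> Ad = A ^^ p)"

(* The projection onto M along N, for algebraically complementary subspaces M and N;
   it need not be the orthogonal projection. *)
definition proj_along :: "'a::ab_group_add set \<Rightarrow> 'a set \<Rightarrow> 'a \<Rightarrow> 'a" where
  "proj_along M N x = (THE y. y \<in> M \<and> x - y \<in> N)"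

(* With respect to H = M1 + M2 (direct), the entry X_ik is the restriction to M_k of X followed
   by the projection onto M_i along the other summand.  The conjuncts are
   X_12 = 0, X_21 = 0 and X_22 = 0. *)
definition only_11_block :: "'a::ab_group_add set \<Rightarrow> 'a set \<Rightarrow> ('a \<Rightarrow> 'a) \<Rightarrow> bool" where
  "only_11_block M1 M2 X \<longleftrightarrow>
     (\<forall>x\<in>M2. proj_along M1 M2 (X x) = 0) \<and>
     (\<forall>x\<in>M1. proj_along M2 M1 (X x) = 0) \<and>
     (\<forall>x\<in>M2. proj_along M2 M1 (X x) = 0)"

(* Used to read the decomposition into range (A ^^ p) and ker (A ^^ p) as a Hilbert space direct
   sum when B is the adjoint of A or of its Drazin inverse; then the adjoint of the sum of A_1 and
   A_2 is the sum of their adjoints.  For oblique summands part (i) fails for these two B: let e, f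
   be orthonormal, A x = <x, e + f> e (so A A = A, the Drazin inverse of A is A, p = 1),
   X = A* A and m = 1.  Then A* X A = X, but X e = e + f does not lie in range A = span {e}. *)
definition orthogonal_sets :: "'a::complex_inner set \<Rightarrow> 'a set \<Rightarrow> bool" where
  "orthogonal_sets M N \<longleftrightarrow> (\<forall>x\<in>M. \<forall>y\<in>N. cinner x y = 0)"

lemma drazin_decomposition:
  assumes A: "A \<in> bounded_ops" and D: "drazin_inverse A Ad" and p: "p = drazin_index A Ad"
  shows "\<exists>!y. y \<in> range (A ^^ p) \<and> x - y \<in> {z. (A ^^ p) z = 0}"
proof -
  have comm: "Ad (A z) = A (Ad z)" for z
    using D by (metis comp_apply drazin_inverse_def)
  have "p \<ge> 1 \<and> (A ^^ (p + 1)) \<circ> Ad = A ^^ p"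
    unfolding p drazin_index_def
    by (rule LeastI_ex) (use D in \<open>auto simp: drazin_inverse_def\<close>)
  then have ind: "(A ^^ p) (A (Ad z)) = (A ^^ p) z" for z
    by (metis Suc_eq_plus1 comp_apply funpow_Suc_right)
  have lin: "linear (A ^^ n)" for n
  proof (induction n)
    case (Suc n)
    have "linear A" using A by (simp add: bounded_ops_def bounded_linear.linear)
    then have "linear (A \<circ> (A ^^ n))" using linear_compose Suc by blast
    then show ?case by (simp add: o_def)
  qed (simp add: linear_iff)
  have pw: "(A ^^ n) ((Ad ^^ n) (A (Ad z))) = A (Ad z)" for n z
  proof (induction n)
    case (Suc n)
    have "Ad (Ad (A w)) = Ad w" for w
      using D by (auto simp: drazin_inverse_def fun_eq_iff numeral_2_eq_2)
    then have sq: "A (Ad (A (Ad w))) = A (Ad w)" for w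
      by (simp add: comm)
    have shift: "A (Ad ((Ad ^^ n) w)) = (Ad ^^ n) (A (Ad w))" for n w
      by (induction n) (simp_all flip: comm)
    have "(A ^^ Suc n) ((Ad ^^ Suc n) (A (Ad z))) = (A ^^ n) (A (Ad ((Ad ^^ n) (A (Ad z)))))"
      by (simp add: funpow_swap1)
    also have "\<dots> = A (Ad z)" using shift sq Suc by simp
    finally show ?case .
  qed simp
  have P: "A (Ad ((A ^^ n) w)) = (A ^^ n) (A (Ad w))" for n w
    by (induction n) (simp_all add: comm)
  show ?thesis
  proof (rule ex1I)
    have "A (Ad x) \<in> range (A ^^ p)" by (metis pw rangeI)
    moreover have "(A ^^ p) (x - A (Ad x)) = 0" using lin ind by (simp add: linear_diff)
    ultimately show "A (Ad x) \<in> range (A ^^ p) \<and> x - A (Ad x) \<in> {z. (A ^^ p) z = 0}" by simp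
  next
    fix y assume y: "y \<in> range (A ^^ p) \<and> x - y \<in> {z. (A ^^ p) z = 0}"
    then obtain w where w: "y = (A ^^ p) w" by auto
    have Ay: "A (Ad y) = y" by (simp add: w P ind)
    have "(A ^^ p) x = (A ^^ p) y" using y lin by (simp add: linear_diff)
    moreover have "A (Ad z) = (Ad ^^ p) ((A ^^ p) (A (Ad z)))" for z
    proof -
      have "(Ad ^^ n) (A u) = A ((Ad ^^ n) u)" for n u
        by (induction n) (simp_all add: comm)
      then have "(Ad ^^ k) ((A ^^ n) u) = (A ^^ n) ((Ad ^^ k) u)" for k n u
        by (induction n) simp_all
      then show ?thesis using pw by simp
    qed
    ultimately show "y = A (Ad x)" by (metis Ay ind)
  qed
qed

end

theory Submission imports Defs begin

text \<open>
  Let \<open>L Y = S Y T\<close>, so that the triangle sum of order \<open>m\<close> is \<open>(L - 1)\<^sup>m X\<close>.  If only the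
  restrictions of maps to \<open>ker T\<^sup>q\<close> are considered, then \<open>L\<^sup>q = 0\<close>; the same holds if maps are
  considered modulo the range of \<open>S\<^sup>q\<close>.  A nilpotent \<open>L\<close> makes \<open>L - 1\<close> injective, so
  \<open>(L - 1)\<^sup>m X = 0\<close> forces \<open>X\<close> to be zero in both situations.  Hence \<open>X\<close> vanishes on \<open>ker T\<^sup>q\<close>
  (\<open>triangle_zero_on_kernel\<close>), and if \<open>S\<close> has Drazin inverse \<open>R\<close>, then \<open>S R X = X\<close>
  (\<open>triangle_zero_range_fixed\<close>).  Both lemmas are proved by induction on the order of
  nilpotency: once the higher terms of the sum vanish, the term \<open>\<plusminus>X\<close> is the only one left.

  The roles of \<open>(S, R)\<close> are played by \<open>(A, Ad)\<close>, \<open>(Ad, A)\<close> and the two pairs of adjoints.  For the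
  first two, \<open>S R\<close> is the projection onto \<open>H1\<close> along \<open>H2\<close>, which gives the block form of \<open>X\<close>.  For
  the adjoints, \<open>S R\<close> is the adjoint of that projection, which is the projection itself when
  \<open>H1\<close> and \<open>H2\<close> are orthogonal.  The implications from triangle to delta use only \<open>S R X = X\<close>: applying
  \<open>R\<^sup>m\<close> to the triangle sum for \<open>(S, T)\<close> yields, up to sign, the delta sum for \<open>(R, T)\<close>.

  To work with adjoints one has to know that they exist; this is the Riesz representation theorem,
  proved here by minimising a quadratic functional.
\<close>

section \<open>Real-linear expansion of the triangle and delta sums\<close>

lemma linear_funpow:
  fixes S :: "'a::real_vector \<Rightarrow> 'a"
  assumes "linear S"
  shows "linear (S ^^ n)"
proof (induction n)
  case (Suc n)
  then show ?case using linear_compose[OF Suc assms] by (simp add: o_def)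
qed (simp add: linear_iff)

text \<open>The coefficients are real, so that real-linear maps can be moved through the sums.\<close>
lemma coefficient_scaleR:
  "((- 1) ^ j * of_nat n) *\<^sub>C (x::'a::complex_inner) = ((- 1) ^ j * real n) *\<^sub>R x"
  by (simp add: scaleR_scaleC)

lemma linear_triangle_expand:
  assumes "linear F"
  shows "F (triangle m S T X x) =
    (\<Sum>j=0..m. ((- 1) ^ j * real (m choose j)) *\<^sub>R F ((S ^^ (m - j)) (X ((T ^^ (m - j)) x))))"
  by (simp add: triangle_def coefficient_scaleR linear_sum[OF assms] linear_scale[OF assms])

lemma triangle_isolate_constant_term:
  assumes "linear F" and "triangle m S T X = (\<lambda>x. 0)"
    and "\<And>k. k \<ge> 1 \<Longrightarrow> F ((S ^^ k) (X ((T ^^ k) x))) = 0"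
  shows "F (X x) = 0"
proof -
  have "0 = F (triangle m S T X x)"
    using assms(1,2) by (simp add: linear_0)
  also have "\<dots> = (\<Sum>j=0..m. if j = m then (- 1) ^ m *\<^sub>R F (X x) else 0)"
    unfolding linear_triangle_expand[OF assms(1)]
    by (rule sum.cong) (auto simp: assms(3))
  also have "\<dots> = (- 1) ^ m *\<^sub>R F (X x)"
    by simp
  finally show ?thesis
    by simp
qed

section \<open>A solution lives on the invertible parts\<close>

text \<open>If \<open>T\<^sup>q\<^sup>+\<^sup>1 x = 0\<close>, then by induction \<open>X\<close> kills \<open>T\<^sup>k x\<close> for every \<open>k \<ge> 1\<close>, and only the
  term \<open>\<plusminus>X x\<close> survives in the sum evaluated at \<open>x\<close>.\<close>
lemma triangle_zero_on_kernel:
  assumes "linear S" and "linear T" and "linear X"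
    and tri: "triangle m S T X = (\<lambda>x. 0)"
    and "(T ^^ q) x = 0"
  shows "X x = 0"
  using \<open>(T ^^ q) x = 0\<close>
proof (induction q arbitrary: x)
  case 0
  then show ?case using \<open>linear X\<close> by (simp add: linear_0)
next
  case (Suc q)
  have "(S ^^ k) (X ((T ^^ k) x)) = 0" if "k \<ge> 1" for k
  proof -
    have "(T ^^ q) ((T ^^ k) x) = (T ^^ (k - 1)) ((T ^^ Suc q) x)"
      using that by (simp only: funpow_add[THEN fun_cong, unfolded o_apply, symmetric])
        (simp add: add.commute)
    also have "\<dots> = 0"
      using Suc.prems linear_funpow[OF \<open>linear T\<close>] linear_0 by metis
    finally show ?thesis
      using Suc.IH linear_funpow[OF \<open>linear S\<close>] by (simp add: linear_0)
  qed
  then show ?case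
    using triangle_isolate_constant_term[where F = "\<lambda>x. x", OF linear_ident tri] by simp
qed

text \<open>The dual statement.  The induction needs an arbitrary linear \<open>F\<close>, because it passes from
  \<open>F\<close> to \<open>F \<circ> S\<^sup>k\<close> with \<open>k \<ge> 1\<close>; again only the term \<open>\<plusminus>F (X x)\<close> survives.\<close>
lemma triangle_zero_modulo_range:
  fixes F :: "'a::complex_inner \<Rightarrow> 'a"
  assumes "linear S"
    and tri: "triangle m S T X = (\<lambda>x. 0)"
    and "linear F" and "\<And>y. F ((S ^^ q) y) = 0"
  shows "F (X x) = 0"
  using assms(3,4)
proof (induction q arbitrary: F x)
  case 0
  then show ?case by simp
next
  case (Suc q)
  have "F ((S ^^ k) (X ((T ^^ k) x))) = 0" if "k \<ge> 1" for k
  proof -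
    have lin: "linear (\<lambda>y. F ((S ^^ k) y))"
      using linear_compose[OF linear_funpow[OF \<open>linear S\<close>] Suc.prems(1)] by (simp add: o_def)
    have "F ((S ^^ k) ((S ^^ q) y)) = F ((S ^^ Suc q) ((S ^^ (k - 1)) y))" for y
      using that by (simp only: funpow_add[THEN fun_cong, unfolded o_apply, symmetric])
        (simp add: add.commute)
    then show ?thesis
      using Suc.IH[OF lin] Suc.prems(2) by simp
  qed
  then show ?case
    by (rule triangle_isolate_constant_term[OF Suc.prems(1) tri])
qed

text \<open>When \<open>R\<close> is the Drazin inverse of \<open>S\<close>, the map \<open>S \<circ> R\<close> is the projection onto the invertible
  part of \<open>S\<close>.  Since \<open>S\<^sup>q\<close> maps into that part, \<open>F = 1 - S \<circ> R\<close> kills the range of \<open>S\<^sup>q\<close>, and the previous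
  lemma applies.\<close>
lemma triangle_zero_range_fixed:
  assumes "linear S" and "linear R"
    and comm: "\<And>y. R (S y) = S (R y)"
    and ind: "\<And>y. (S ^^ q) (S (R y)) = (S ^^ q) y"
    and tri: "triangle m S T X = (\<lambda>x. 0)"
  shows "S (R (X x)) = X x"
proof -
  have lin: "linear (\<lambda>y. y - S (R y))"
    using linear_compose_sub[OF linear_ident linear_compose[OF assms(2,1)]] by (simp add: o_def)
  have "S (R ((S ^^ n) y)) = (S ^^ n) (S (R y))" for n y
    by (induction n) (simp_all add: comm)
  then have "X x - S (R (X x)) = 0"
    by (intro triangle_zero_modulo_range[OF assms(1) tri lin, of q]) (simp add: ind)
  then show ?thesis
    by simp
qed

lemma funpow_cancel_fixed:
  assumes comm: "\<And>y. R (S y) = S (R y)" and "S (R y) = y"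
  shows "(S ^^ n) ((R ^^ n) y) = y"
  using assms(2)
proof (induction n arbitrary: y)
  case (Suc n)
  have "S (R (R y)) = R y"
    using Suc.prems by (metis comm)
  then have "(S ^^ n) ((R ^^ n) (R y)) = R y"
    by (rule Suc.IH)
  then show ?case
    using Suc.prems by (simp add: funpow_swap1[of R])
qed simp

section \<open>From triangle to delta\<close>

text \<open>Since \<open>S\<close> and \<open>R\<close> are inverse to each other on the range of \<open>X\<close>, applying \<open>R\<^sup>m\<close> turns
  \<open>S\<^sup>m\<^sup>-\<^sup>j X T\<^sup>m\<^sup>-\<^sup>j\<close> into \<open>R\<^sup>j X T\<^sup>m\<^sup>-\<^sup>j\<close>; up to the sign \<open>(- 1)\<^sup>m\<close>, the result is the delta sum
  read backwards.\<close>
lemma delta_zero_if_triangle_zero: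
  assumes "linear S" and "linear R"
    and comm: "\<And>y. R (S y) = S (R y)"
    and ind: "\<And>y. (S ^^ q) (S (R y)) = (S ^^ q) y"
    and tri: "triangle m S T X = (\<lambda>x. 0)"
  shows "delta m R T X = (\<lambda>x. 0)"
proof
  fix x
  have fixed: "R (S (X z)) = X z" for z
    using triangle_zero_range_fixed[OF assms] comm by simp
  have cancel: "(R ^^ m) ((S ^^ (m - j)) (X z)) = (R ^^ j) (X z)" if "j \<le> m" for j z
  proof -
    have "(R ^^ m) w = (R ^^ j) ((R ^^ (m - j)) w)" for w
      using that by (simp flip: funpow_add[THEN fun_cong, unfolded o_apply])
    then show ?thesis
      using funpow_cancel_fixed[of S R, OF comm[symmetric] fixed] by simp
  qed
  have "0 = (R ^^ m) (triangle m S T X x)"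
    using linear_0[OF linear_funpow[OF assms(2)]] by (simp add: tri)
  also have "\<dots> = (\<Sum>j=0..m. ((- 1) ^ j * real (m choose j)) *\<^sub>R (R ^^ j) (X ((T ^^ (m - j)) x)))"
    unfolding linear_triangle_expand[OF linear_funpow[OF assms(2)]]
    by (rule sum.cong) (simp_all add: cancel)
  also have "\<dots> = (\<Sum>j=0..m. ((- 1) ^ (m - j) * real (m choose (m - j))) *\<^sub>R
      (R ^^ (m - j)) (X ((T ^^ (m - (m - j))) x)))"
    by (subst sum.atLeastAtMost_rev) simp
  also have "\<dots> = (\<Sum>j=0..m. (- 1) ^ m *\<^sub>R
      (((- 1) ^ j * real (m choose j)) *\<^sub>R (R ^^ (m - j)) (X ((T ^^ j) x))))"
  proof (rule sum.cong)
    fix j assume "j \<in> {0..m}"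
    then have j: "j \<le> m"
      by simp
    then have "(- 1::real) ^ (m - j) = (- 1) ^ m * (- 1) ^ j"
      by (simp add: minus_one_power_iff)
    then show "((- 1) ^ (m - j) * real (m choose (m - j))) *\<^sub>R
        (R ^^ (m - j)) (X ((T ^^ (m - (m - j))) x)) =
      (- 1) ^ m *\<^sub>R (((- 1) ^ j * real (m choose j)) *\<^sub>R (R ^^ (m - j)) (X ((T ^^ j) x)))"
      using j by (simp add: binomial_symmetric[of j m])
  qed simp
  also have "\<dots> = (- 1) ^ m *\<^sub>R delta m R T X x"
    by (simp only: delta_def coefficient_scaleR scaleR_sum_right o_apply)
  finally show "delta m R T X x = 0"
    by simp
qed

section \<open>Adjoints on complex Hilbert spaces\<close>

lemma cinner_zero_left [simp]: "cinner 0 (y::'a::complex_inner) = 0"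
  using cinner_add_left[of 0 0 y] by simp

lemma cinner_zero_right [simp]: "cinner (y::'a::complex_inner) 0 = 0"
  by (subst cinner_commute) simp

lemma cinner_add_right: "cinner x (y + z) = cinner x y + cinner x (z::'a::complex_inner)"
  by (metis cinner_add_left cinner_commute complex_cnj_add)

lemma cinner_scaleR_left: "cinner (r *\<^sub>R x) y = r * cinner x (y::'a::complex_inner)"
  by (simp add: scaleR_scaleC cinner_scaleC_left)

lemma cinner_scaleR_right: "cinner x (r *\<^sub>R y) = r * cinner x (y::'a::complex_inner)"
  by (metis cinner_scaleR_left cinner_commute complex_cnj_mult complex_cnj_complex_of_real)

lemma cinner_scaleC_right: "cinner x (c *\<^sub>C y) = cnj c * cinner x (y::'a::complex_inner)"
  by (metis cinner_scaleC_left cinner_commute complex_cnj_mult)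

lemma cinner_minus_left: "cinner (- x) y = - cinner x (y::'a::complex_inner)"
  using cinner_add_left[of x "- x" y] by (simp add: minus_unique)

lemma cinner_diff_right: "cinner x (y - z) = cinner x y - cinner x (z::'a::complex_inner)"
  using cinner_add_right[of x "y - z" z] by simp

lemma cinner_self_eq_zero: "cinner x x = 0 \<longleftrightarrow> x = (0::'a::complex_inner)"
  by (simp flip: norm_eq_cinner)

lemma eq_if_cinner_eq:
  assumes "\<And>x. cinner x y = cinner x (z::'a::complex_inner)"
  shows "y = z"
  using assms cinner_self_eq_zero[of "y - z"] by (simp add: cinner_diff_right)

lemma power2_norm_add:
  "(norm (x + y))\<^sup>2 = (norm x)\<^sup>2 + (norm y)\<^sup>2 + 2 * Re (cinner x (y::'a::complex_inner))"
proof -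
  have norm_sq: "(norm z)\<^sup>2 = Re (cinner z z)" for z :: 'a
    by (simp flip: norm_eq_cinner)
  have "Re (cinner y x) = Re (cinner x y)"
    by (subst cinner_commute) simp
  then show ?thesis
    by (simp add: norm_sq cinner_add_left cinner_add_right)
qed

text \<open>The representing vector minimises \<open>\<phi> y = \<parallel>y\<parallel>\<^sup>2 - 2 g y\<close>.  By the parallelogram law every
  minimising sequence is Cauchy, and the derivative of \<open>\<phi>\<close> vanishes at the minimum.\<close>
lemma real_riesz_representation:
  fixes g :: "'a::chilbert_space \<Rightarrow> real"
  assumes g: "bounded_linear g"
  shows "\<exists>y. \<forall>x. g x = Re (cinner x y)"
proof -
  interpret g: bounded_linear g by (rule g)
  define \<phi> where "\<phi> y = (norm y)\<^sup>2 - 2 * g y" for y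
  obtain K where K: "\<And>y. norm (g y) \<le> norm y * K"
    using g.bounded by auto
  have "- K\<^sup>2 \<le> \<phi> y" for y
  proof -
    have "g y \<le> norm y * K" using K[of y] by simp
    moreover have "0 \<le> (norm y - K)\<^sup>2" by simp
    ultimately show ?thesis by (simp add: \<phi>_def power2_diff)
  qed
  then have bdd: "bdd_below (range \<phi>)"
    by (intro bdd_belowI2)
  define I where "I = Inf (range \<phi>)"
  have I_le: "I \<le> \<phi> y" for y
    unfolding I_def by (rule cInf_lower[OF _ bdd]) simp
  have "\<exists>y. \<phi> y < I + inverse (real (Suc n))" for n
    using cInf_lessD[of "range \<phi>" "I + inverse (real (Suc n))"] by (auto simp: I_def)
  then obtain u where u: "\<And>n. \<phi> (u n) < I + inverse (real (Suc n))"
    by metis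
  have parallelogram: "(norm (v - w))\<^sup>2 = 2 * \<phi> v + 2 * \<phi> w - 4 * \<phi> ((1/2) *\<^sub>R (v + w))" for v w
  proof -
    have "(norm (v - w))\<^sup>2 = (norm v)\<^sup>2 + (norm w)\<^sup>2 - 2 * Re (cinner v w)"
      using power2_norm_add[of v "(-1) *\<^sub>R w"] by (simp only: cinner_scaleR_right) simp
    moreover have "g ((1/2) *\<^sub>R (v + w)) = (g v + g w) / 2"
      using g.scaleR[of "1/2" "v + w"] by (simp add: g.add del: scaleR_add_right)
    moreover have "(norm ((1/2) *\<^sub>R (v + w)))\<^sup>2 = (norm (v + w))\<^sup>2 / 4"
      by (simp add: power_divide del: scaleR_add_right)
    ultimately show ?thesis
      by (simp only: \<phi>_def power2_norm_add) argo
  qed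
  have "Cauchy u"
  proof (rule CauchyI)
    fix e :: real assume "e > 0"
    then obtain M where M: "inverse (real (Suc M)) < e\<^sup>2 / 4"
      using reals_Archimedean[of "e\<^sup>2 / 4"] by auto
    have near: "\<phi> (u n) < I + e\<^sup>2 / 4" if "n \<ge> M" for n
    proof -
      have "inverse (real (Suc n)) \<le> inverse (real (Suc M))"
        using that by (intro le_imp_inverse_le) auto
      then show ?thesis using u[of n] M by linarith
    qed
    have "norm (u k - u n) < e" if "k \<ge> M" "n \<ge> M" for k n
    proof -
      have "(norm (u k - u n))\<^sup>2 < e\<^sup>2"
        using parallelogram[of "u k" "u n"] near[OF that(1)] near[OF that(2)]
          I_le[of "(1/2) *\<^sub>R (u k + u n)"] by linarith
      then show ?thesis
        using \<open>e > 0\<close> by (simp add: power_less_imp_less_base)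
    qed
    then show "\<exists>M. \<forall>k\<ge>M. \<forall>n\<ge>M. norm (u k - u n) < e"
      by blast
  qed
  then obtain y where y: "u \<longlonglongrightarrow> y"
    using Cauchy_convergent_iff convergent_def by blast
  have "(\<lambda>n. \<phi> (u n)) \<longlonglongrightarrow> \<phi> y"
    unfolding \<phi>_def by (intro tendsto_intros y g.tendsto)
  moreover have "(\<lambda>n. I + inverse (real (Suc n))) \<longlonglongrightarrow> I + 0"
    by (intro tendsto_intros LIMSEQ_inverse_real_of_nat)
  ultimately have "\<phi> y \<le> I"
    using LIMSEQ_le[of "\<lambda>n. \<phi> (u n)"] less_imp_le[OF u] by fastforce
  then have minimal: "\<phi> y \<le> \<phi> z" for z
    using I_le[of z] by linarith
  have "g x = Re (cinner x y)" for x
  proof (cases "x = 0")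
    case True
    then show ?thesis by (simp add: g.zero)
  next
    case False
    define c where "c = Re (cinner x y) - g x"
    \<comment> \<open>This \<open>t\<close> minimises the quadratic polynomial \<open>t \<mapsto> \<phi> (y + t x)\<close>.\<close>
    define t where "t = - c / (norm x)\<^sup>2"
    have "\<phi> (t *\<^sub>R x + y) - \<phi> y = t\<^sup>2 * (norm x)\<^sup>2 + 2 * t * c"
      unfolding \<phi>_def power2_norm_add[of "t *\<^sub>R x" y]
      by (simp add: c_def cinner_scaleR_left g.add g.scaleR power_mult_distrib algebra_simps)
    also have "\<dots> = - (c\<^sup>2 / (norm x)\<^sup>2)"
      using False by (simp add: t_def field_simps power2_eq_square)
    finally have "c\<^sup>2 / (norm x)\<^sup>2 \<le> 0"
      using minimal[of "t *\<^sub>R x + y"] by linarith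
    then have "c = 0"
      using False by (simp add: divide_le_0_iff)
    then show ?thesis by (simp add: c_def)
  qed
  then show ?thesis by blast
qed

text \<open>A complex-linear functional \<open>f\<close> is determined by its real part, \<open>f x = g x - \<i> g (\<i> x)\<close> with
  \<open>g = Re \<circ> f\<close>, so the vector that represents \<open>g\<close> represents \<open>f\<close>.\<close>
lemma riesz_representation:
  fixes f :: "'a::chilbert_space \<Rightarrow> complex"
  assumes "bounded_linear f" and scale: "\<And>c x. f (c *\<^sub>C x) = c * f x"
  shows "\<exists>y. \<forall>x. f x = cinner x y"
proof -
  have "bounded_linear (\<lambda>x. Re (f x))"
    using bounded_linear_compose[OF bounded_linear_Re assms(1)] .
  then obtain y where y: "\<And>x. Re (f x) = Re (cinner x y)"
    using real_riesz_representation by blast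
  have "f x = cinner x y" for x
    using y[of x] y[of "\<i> *\<^sub>C x"] by (simp add: complex_eq_iff scale cinner_scaleC_left)
  then show ?thesis by blast
qed

lemma bounded_linear_cinner_left: "bounded_linear (\<lambda>x. cinner x (y::'a::complex_inner))"
proof (rule bounded_linear_intro[where K = "2 * norm y"])
  show "norm (cinner x y) \<le> norm x * (2 * norm y)" for x
  proof -
    \<comment> \<open>A crude form of the Cauchy-Schwarz inequality: \<open>Re \<langle>x,y\<rangle>\<close> is controlled by the triangle
      inequality for \<open>x + y\<close>, and \<open>Im\<close> by replacing \<open>x\<close> with \<open>\<i> x\<close>.\<close>
    have re: "Re (cinner z y) \<le> norm z * norm y" for z :: 'a
    proof -
      have "(norm (z + y))\<^sup>2 \<le> (norm z + norm y)\<^sup>2"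
        by (intro power_mono norm_triangle_ineq) simp
      then show ?thesis by (simp add: power2_norm_add power2_sum)
    qed
    have norm_scale: "norm (c *\<^sub>C x) = norm x" if "c * cnj c = 1" for c
    proof -
      have "complex_of_real ((norm (c *\<^sub>C x))\<^sup>2) = c * cnj c * cinner x x"
        unfolding norm_eq_cinner by (simp add: cinner_scaleC_left cinner_scaleC_right)
      then have "(norm (c *\<^sub>C x))\<^sup>2 = (norm x)\<^sup>2"
        using that norm_eq_cinner[of x] by (metis mult_1 of_real_eq_iff)
      then show ?thesis by simp
    qed
    have "\<bar>Re (cinner x y)\<bar> \<le> norm x * norm y"
      using re[of x] re[of "- x"] by (simp add: cinner_minus_left)
    moreover have "\<bar>Im (cinner x y)\<bar> \<le> norm x * norm y"
      using re[of "\<i> *\<^sub>C x"] re[of "- (\<i> *\<^sub>C x)"] norm_scale[of "\<i>"]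
      by (simp add: cinner_scaleC_left cinner_minus_left)
    ultimately show ?thesis
      using cmod_le[of "cinner x y"] by simp
  qed
qed (simp_all add: cinner_add_left cinner_scaleR_left scaleR_conv_of_real)

lemma cinner_cadjoint:
  fixes A :: "'a::chilbert_space \<Rightarrow> 'a"
  assumes "A \<in> bounded_ops"
  shows "cinner (A x) y = cinner x (cadjoint A y)"
proof -
  have "\<exists>z. \<forall>x. cinner (A x) y = cinner x z" for y
  proof (rule riesz_representation)
    show "bounded_linear (\<lambda>x. cinner (A x) y)"
      using bounded_linear_compose[OF bounded_linear_cinner_left] assms
      by (auto simp: bounded_ops_def)
  qed (use assms in \<open>simp add: bounded_ops_def cinner_scaleC_left\<close>)
  then obtain G where G: "\<forall>x y. cinner (A x) y = cinner x (G y)"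
    by metis
  have "\<forall>x y. cinner (A x) y = cinner x (cadjoint A y)"
    unfolding cadjoint_def
  proof (rule theI[of _ G])
    fix G' assume "\<forall>x y. cinner (A x) y = cinner x (G' y)"
    then have "cinner x (G' y) = cinner x (G y)" for x y
      using G by simp
    then show "G' = G"
      by (intro ext eq_if_cinner_eq)
  qed (rule G)
  then show ?thesis by blast
qed

lemma linear_cadjoint:
  fixes A :: "'a::chilbert_space \<Rightarrow> 'a"
  assumes "A \<in> bounded_ops"
  shows "linear (cadjoint A)"
proof (rule linearI)
  show "cadjoint A (x + y) = cadjoint A x + cadjoint A y" for x y
    by (rule eq_if_cinner_eq) (simp add: cinner_add_right flip: cinner_cadjoint[OF assms])
  show "cadjoint A (r *\<^sub>R x) = r *\<^sub>R cadjoint A x" for r x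
    by (rule eq_if_cinner_eq) (simp add: cinner_scaleR_right flip: cinner_cadjoint[OF assms])
qed

lemma cinner_cadjoint_funpow:
  fixes A :: "'a::chilbert_space \<Rightarrow> 'a"
  assumes "A \<in> bounded_ops"
  shows "cinner x ((cadjoint A ^^ n) y) = cinner ((A ^^ n) x) y"
  by (induction n arbitrary: x)
    (simp_all add: funpow_swap1[of A] flip: cinner_cadjoint[OF assms])

section \<open>Drazin invertible operators\<close>

lemma drazin_inverse_commute:
  assumes "drazin_inverse A Ad"
  shows "Ad (A y) = A (Ad y)"
  using assms by (metis comp_apply drazin_inverse_def)

lemma drazin_inverse_outer:
  assumes "drazin_inverse A Ad"
  shows "Ad (Ad (A y)) = Ad y"
  using assms by (auto simp: drazin_inverse_def fun_eq_iff numeral_2_eq_2)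

lemma drazin_index_power:
  assumes "drazin_inverse A Ad" and "p = drazin_index A Ad"
  shows "(A ^^ p) (A (Ad y)) = (A ^^ p) y"
proof -
  have "p \<ge> 1 \<and> (A ^^ (p + 1)) \<circ> Ad = A ^^ p"
    unfolding assms(2) drazin_index_def
    by (rule LeastI_ex) (use assms(1) in \<open>auto simp: drazin_inverse_def\<close>)
  then show ?thesis
    by (metis Suc_eq_plus1 comp_apply funpow_Suc_right)
qed

text \<open>With \<open>P = A \<circ> Ad\<close> one has \<open>P = Ad\<^sup>n \<circ> A\<^sup>n \<circ> P\<close>, and \<open>P\<close> commutes with \<open>A\<^sup>n\<close>, so \<open>P\<close> kills the
  kernel of \<open>A\<^sup>n\<close>.\<close>
lemma drazin_projection_kernel:
  assumes D: "drazin_inverse A Ad" and "linear A" and "linear Ad" and "(A ^^ n) y = 0"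
  shows "A (Ad y) = 0"
proof -
  have comm: "Ad (A z) = A (Ad z)" for z
    by (rule drazin_inverse_commute[OF D])
  have fixed: "Ad (A (A (Ad y))) = A (Ad y)"
    using drazin_inverse_outer[OF D] by (simp add: comm)
  have "A (Ad ((A ^^ n) z)) = (A ^^ n) (A (Ad z))" for n z
    by (induction n) (simp_all add: comm)
  then have "(A ^^ n) (A (Ad y)) = 0"
    using assms by (metis linear_0)
  moreover have "(Ad ^^ n) ((A ^^ n) (A (Ad y))) = A (Ad y)"
    using funpow_cancel_fixed[of A Ad, OF comm[symmetric] fixed] .
  ultimately show ?thesis
    using linear_0[OF linear_funpow[OF \<open>linear Ad\<close>]] by simp
qed

text \<open>With oblique summands the adjoint projection \<open>(A \<circ> Ad)\<^sup>*\<close> has range \<open>(ker A\<^sup>p)\<^sup>\<bottom>\<close>; when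
  the summands are orthogonal this is the range of \<open>A\<^sup>p\<close>.\<close>
lemma fixed_by_adjoint_projection:
  fixes A :: "'a::chilbert_space \<Rightarrow> 'a"
  assumes A: "A \<in> bounded_ops" and D: "drazin_inverse A Ad" and p: "p = drazin_index A Ad"
    and orth: "orthogonal_sets (range (A ^^ p)) {x. (A ^^ p) x = 0}"
    and y: "cadjoint A (cadjoint Ad y) = y"
  shows "y \<in> range (A ^^ p)"
proof -
  have Ad: "Ad \<in> bounded_ops"
    using D by (simp add: drazin_inverse_def)
  obtain v where v: "v \<in> range (A ^^ p)" and u: "(A ^^ p) (y - v) = 0"
    using drazin_decomposition[OF A D p, of y] by auto
  have "A (Ad (y - v)) = 0"
    using drazin_projection_kernel[OF D _ _ u] A Ad
    by (auto simp: bounded_ops_def bounded_linear.linear)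
  then have "cinner (y - v) y = 0"
    using cinner_cadjoint[OF A] cinner_cadjoint[OF Ad] drazin_inverse_commute[OF D]
    by (metis y cinner_zero_left)
  moreover have "cinner (y - v) v = 0"
    using orth v u unfolding orthogonal_sets_def
    by (subst cinner_commute) auto
  ultimately have "cinner (y - v) (y - v) = 0"
    by (simp add: cinner_diff_right)
  then have "y = v"
    using cinner_self_eq_zero[of "y - v"] by simp
  then show ?thesis using v by simp
qed

lemma only_11_blockI:
  fixes M1 M2 :: "'a::real_vector set"
  assumes "subspace M1" and "subspace M2"
    and disjoint: "\<And>z. z \<in> M1 \<Longrightarrow> z \<in> M2 \<Longrightarrow> z = 0"
    and X: "\<And>x. X x \<in> M1" "\<And>x. x \<in> M2 \<Longrightarrow> X x = 0"
  shows "only_11_block M1 M2 X"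
proof -
  have zero: "0 \<in> M1" "0 \<in> M2"
    using assms(1,2) by (simp_all add: subspace_0)
  have "proj_along M1 M2 0 = 0"
    unfolding proj_along_def
  proof (rule the_equality)
    fix z assume z: "z \<in> M1 \<and> 0 - z \<in> M2"
    then have "- (0 - z) \<in> M2"
      using subspace_neg[OF assms(2)] by blast
    then show "z = 0" using z disjoint by simp
  qed (use zero in simp)
  moreover have "proj_along M2 M1 y = 0" if "y \<in> M1" for y
    unfolding proj_along_def
  proof (rule the_equality)
    fix z assume z: "z \<in> M2 \<and> y - z \<in> M1"
    then have "y - (y - z) \<in> M1"
      using that subspace_diff[OF assms(1)] by blast
    then show "z = 0" using z disjoint by simp
  qed (use zero that in simp)
  ultimately show ?thesis
    using zero X by (simp add: only_11_block_def)
qed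

theorem theorem2p6:
  fixes A Ad X :: "'a::chilbert_space \<Rightarrow> 'a" and m p :: nat and H1 H2 :: "'a set"
  assumes "infinite_dimensional TYPE('a)"
    and "A \<in> bounded_ops" and "X \<in> bounded_ops"
    and "drazin_inverse A Ad" and "p = drazin_index A Ad"
    and "m \<ge> 1"
    and "H1 = range (A ^^ p)" and "H2 = {x. (A ^^ p) x = 0}"
  shows
    "(\<forall>B. (B \<in> {A, Ad} \<or> (B \<in> {cadjoint A, cadjoint Ad} \<and> orthogonal_sets H1 H2)) \<and>
          left_invertible X m B A
        \<longrightarrow> only_11_block H1 H2 X) \<and>
     (triangle m A A X = (\<lambda>x. 0) \<longrightarrow> delta m Ad A X = (\<lambda>x. 0)) \<and>
     (triangle m Ad A X = (\<lambda>x. 0) \<longrightarrow> delta m A A X = (\<lambda>x. 0)) \<and>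
     (triangle m (cadjoint A) A X = (\<lambda>x. 0) \<longrightarrow> delta m (cadjoint Ad) A X = (\<lambda>x. 0)) \<and>
     (triangle m (cadjoint Ad) A X = (\<lambda>x. 0) \<longrightarrow> delta m (cadjoint A) A X = (\<lambda>x. 0))"
proof -
  note A = assms(2) and D = assms(4) and p = assms(5)
  have Ad: "Ad \<in> bounded_ops"
    using D by (simp add: drazin_inverse_def)
  have lin: "linear A" "linear Ad" "linear X" "linear (cadjoint A)" "linear (cadjoint Ad)"
    using A Ad assms(3) by (auto simp: bounded_ops_def bounded_linear.linear linear_cadjoint)
  have comm: "Ad (A y) = A (Ad y)" for y
    by (rule drazin_inverse_commute[OF D])
  have ind: "(A ^^ p) (A (Ad y)) = (A ^^ p) y" for y
    by (rule drazin_index_power[OF D p])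
  \<comment> \<open>The nilpotent part of \<open>Ad\<close> is the zero operator, so the exponent 1 suffices.\<close>
  have ind_Ad: "(Ad ^^ 1) (Ad (A y)) = (Ad ^^ 1) y" for y
    using drazin_inverse_outer[OF D] by simp
  have adj: "cinner x (cadjoint A y) = cinner (A x) y" "cinner x (cadjoint Ad y) = cinner (Ad x) y"
    for x y
    using cinner_cadjoint[OF A] cinner_cadjoint[OF Ad] by simp_all
  have comm': "cadjoint Ad (cadjoint A y) = cadjoint A (cadjoint Ad y)" for y
    by (rule eq_if_cinner_eq) (simp add: adj comm)
  have P: "A (Ad ((A ^^ n) y)) = (A ^^ n) (A (Ad y))" for n y
    by (induction n) (simp_all add: comm)
  have ind': "(cadjoint A ^^ p) (cadjoint A (cadjoint Ad y)) = (cadjoint A ^^ p) y" for y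
    by (rule eq_if_cinner_eq) (simp add: cinner_cadjoint_funpow[OF A] adj comm P ind)
  have ind_Ad': "(cadjoint Ad ^^ 1) (cadjoint Ad (cadjoint A y)) = (cadjoint Ad ^^ 1) y" for y
    using drazin_inverse_outer[OF D] by (intro eq_if_cinner_eq) (simp add: adj comm)
  note lin_pow = linear_funpow[OF lin(1), of p]

  have block: "only_11_block H1 H2 X" if "linear B" and tri: "triangle m B A X = (\<lambda>x. 0)"
    and range: "\<And>x. X x \<in> H1" for B
  proof (rule only_11_blockI)
    show sub: "subspace H1" "subspace H2"
      unfolding assms(7,8)
      by (rule linear_subspace_image[OF lin_pow subspace_UNIV] linear_subspace_kernel[OF lin_pow])+
    show "z = 0" if "z \<in> H1" "z \<in> H2" for z
    proof -
      have "\<exists>!y. y \<in> H1 \<and> z - y \<in> H2"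
        unfolding assms(7,8) by (rule drazin_decomposition[OF A D p])
      moreover have "z \<in> H1 \<and> z - z \<in> H2" "0 \<in> H1 \<and> z - 0 \<in> H2"
        using that sub by (simp_all add: subspace_0)
      ultimately show ?thesis
        by metis
    qed
    show "X x \<in> H1" for x
      by (rule range)
    show "X x = 0" if "x \<in> H2" for x
      using that triangle_zero_on_kernel[OF \<open>linear B\<close> lin(1,3) tri] by (simp add: assms(8))
  qed

  have fixed_H1: "y \<in> H1" if "A (Ad y) = y" for y
    using funpow_cancel_fixed[of Ad A, OF comm that] unfolding assms(7) by (metis rangeI)

  have blocks: "only_11_block H1 H2 X"
    if B: "B \<in> {A, Ad} \<or> (B \<in> {cadjoint A, cadjoint Ad} \<and> orthogonal_sets H1 H2)"
      and "left_invertible X m B A" for B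
  proof -
    have tri: "triangle m B A X = (\<lambda>x. 0)"
      using that(2) by (simp add: left_invertible_def)
    have adjoint_H1: "y \<in> H1"
      if "orthogonal_sets H1 H2" "cadjoint A (cadjoint Ad y) = y" for y
      using fixed_by_adjoint_projection[OF A D p] that by (simp add: assms(7,8))
    have "linear B"
      using B lin by blast
    note blockB = block[OF this tri]
    consider "B = A" | "B = Ad" | "B = cadjoint A" "orthogonal_sets H1 H2"
      | "B = cadjoint Ad" "orthogonal_sets H1 H2"
      using B by blast
    then show ?thesis
    proof cases
      case 1
      have "A (Ad (X x)) = X x" for x
        using triangle_zero_range_fixed[OF lin(1,2) comm ind tri[unfolded 1]] by simp
      then show ?thesis
        by (intro blockB fixed_H1)
    next
      case 2
      have "A (Ad (X x)) = X x" for x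
        using triangle_zero_range_fixed[OF lin(2,1) comm[symmetric] ind_Ad tri[unfolded 2]] comm by simp
      then show ?thesis
        by (intro blockB fixed_H1)
    next
      case 3
      have "cadjoint A (cadjoint Ad (X x)) = X x" for x
        using triangle_zero_range_fixed[OF lin(4,5) comm' ind' tri[unfolded 3(1)]] by simp
      then show ?thesis
        by (intro blockB adjoint_H1[OF 3(2)])
    next
      case 4
      have "cadjoint A (cadjoint Ad (X x)) = X x" for x
        using triangle_zero_range_fixed[OF lin(5,4) comm'[symmetric] ind_Ad' tri[unfolded 4(1)]] comm' by simp
      then show ?thesis
        by (intro blockB adjoint_H1[OF 4(2)])
    qed
  qed
  note deltas =
    delta_zero_if_triangle_zero[OF lin(1,2) comm ind]
    delta_zero_if_triangle_zero[OF lin(2,1) comm[symmetric] ind_Ad]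
    delta_zero_if_triangle_zero[OF lin(4,5) comm' ind']
    delta_zero_if_triangle_zero[OF lin(5,4) comm'[symmetric] ind_Ad']
  show ?thesis
    by (intro conjI allI impI) (erule conjE, erule (1) blocks | erule deltas)+
qed

end
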